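(* In the setting described in the context, suppose Conditions (C1) and (C2) hold, the correction functions have radius $\rho<1$, and $F(x,\theta,\xi)\in\{-1,+1\}$ for all $x\in\mathcal{X}$. Then for all $x\in\mathcal{X}$, $$m_F\big((\theta,\xi),x,\mathbf{1}(F(x,\theta,\xi)\ge0)\big)\ge\min\Big\{\tfrac{B}{\kappa_0},\tfrac{\rho}{\kappa_0},\sigma_\theta,\sigma_\xi,\tfrac{1}{2\kappa_\theta},\tfrac{\rho}{2\kappa_\theta B},\tfrac{\sigma_h}{2\kappa_\xi B},\tfrac{\rho}{4B\kappa_h\kappa_\xi},\tfrac{1}{4\kappa_h\kappa_\xi}\Big\}.$$ Moreover, for any layer-based weight-shared model $F'(x,\theta')=F(x,\tau^{(1)}(\theta'),\tau^{(2)}(\theta'))$ with $\tau^{(1)}(\theta')=\theta$, $\tau^{(2)}(\theta')=\xi$, the same lower bound holds for $m_{F'}(\theta',x,\mathbf{1}(F'(x,\theta')\ge0))$.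
   Context: Architecture: layer functions $f_0:\mathcal{X}\times\Theta_0\to\mathbb{R}^d$, $f_i:(\mathbb{R}^d)^i\times\Theta_i\to\mathbb{R}^d$ for $1\le i<L$, $f_L:(\mathbb{R}^d)^L\times\Theta_L\to\mathbb{R}$; $\theta=(\theta_0,\dots,\theta_L)$; $h_0(x,\theta)=f_0(x,\theta_0)$, $h_i(x,\theta)=f_i(h_0(x,\theta),\dots,h_{i-1}(x,\theta),\theta_i)$. Correction functions: $c_0,\dots,c_{L-1}:\mathbb{R}^d\times\Xi_i\to\mathbb{R}^d$ with parameters $\xi=(\xi_0,\dots,\xi_{L-1})$ have radius $\rho$ if for all $0\le i\le L-1$, $x\in\mathcal{X}$ and $\hat h\in\mathbb{R}^d$ with $\|\hat h-h_i(x,\theta)\|_2\le\rho$, $c_i(\hat h,\xi_i)=h_i(x,\theta)$. Corrected model: $g_0(x,\theta,\xi)=f_0(x,\theta_0)$; $\tilde h_i(x,\theta,\xi)=c_i(g_i(x,\theta,\xi),\xi_i)$ for $0\le i\le L-1$; $g_i(x,\theta,\xi)=f_i(\tilde h_0(x,\theta,\xi),\dots,\tilde h_{i-1}(x,\theta,\xi),\theta_i)$ for $1\le i\le L$; $F(x,\theta,\xi)=g_L(x,\theta,\xi)$ (so $F(x,\theta,\xi)=h_L(x,\theta)$ on $\mathcal{X}$). Norm on tuples: $|||(v_1,\dots,v_i)|||=\max_j\|v_j\|_2$. Niceness: $f(\cdot,\theta)$ is $(\kappa_\theta,\kappa_h,\sigma_h,\sigma_\theta)$-nice on a set $\mathcal{H}$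 if for all $\hat\theta$ with $\|\theta-\hat\theta\|_2\le\sigma_\theta$ and all $h\in\mathcal{H}$: $\|f(h,\theta)-f(h,\hat\theta)\|_2\le\kappa_\theta\|\theta-\hat\theta\|_2\max\{|||h|||,1\}$, and for all $\hat h$ with $|||h-\hat h|||\le\sigma_h$: $\|f(h,\hat\theta)-f(\hat h,\hat\theta)\|_2\le\kappa_h|||h-\hat h|||$. Condition (C1): for each $i\ge1$, $f_i(\cdot,\theta_i)$ is $(\kappa_\theta,\kappa_h,\sigma_h,\sigma_\theta)$-nice on $\{(h_0(x,\theta),\dots,h_{i-1}(x,\theta)):x\in\mathcal{X}\}$; $\|f_0(x,\theta_0)-f_0(x,\hat\theta_0)\|_2\le\kappa_0\|\theta_0-\hat\theta_0\|_2$ for all $x\in\mathcal{X}$ and all $\hat\theta_0$; and for each $i$, $\|c_i(h,\xi_i)-c_i(h,\hat\xi)\|_2\le\kappa_\xi\max\{\|h\|_2,1\}\|\xi_i-\hat\xi\|_2$ for all $h\in\mathbb{R}^d$ and all $\hat\xi$ with $\|\xi_i-\hat\xi\|_2\le\sigma_\xi$. Condition (C2): $\max\{\|h_i(x,\theta)\|_2,1\}\le B$ for all $0\le i\le L$ and $x\in\mathcal{X}$. All-layer margin of an architecture $F$ with parameter vector $\vartheta$: $m_F(\vartheta,x,y)=\min\{\|\delta\|_2:(y-0.5)F(x,\vartheta+\delta)\le0\}$ for $y\in\{0,1\}$. Layer-based weight sharing: $\theta'\in\mathbb{R}^{d'}$, and each component map $\tau^{(1)}_i$ (producing $\theta_i$)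 and $\tau^{(2)}_i$ (producing $\xi_i$) has the form $\theta'\mapsto(\theta'_{\pi_1},\dots,\theta'_{\pi_{b}})$ for distinct indices $\pi_1,\dots,\pi_b\in[d']$ (no coordinate of $\theta'$ is duplicated within one layer). *)

theory Defs
  imports "HOL-Analysis.Analysis"
begin

text \<open>Parameter vectors (elements of some R^p) are represented as real lists;
  hidden states live in a Euclidean space 'v (= R^d).\<close>

definition l2 :: "real list \<Rightarrow> real" where
  "l2 v = sqrt (sum_list (map (\<lambda>a. a\<^sup>2) v))"

definition vsub :: "real list \<Rightarrow> real list \<Rightarrow> real list" where
  "vsub u v = map2 (-) u v"

definition vadd :: "real list \<Rightarrow> real list \<Rightarrow> real list" where
  "vadd u v = map2 (+) u v"

definition tnorm :: "'v::real_normed_vector list \<Rightarrow> real" where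
  "tnorm hs = foldr max (map norm hs) 0"

definition tsub :: "'v::real_normed_vector list \<Rightarrow> 'v list \<Rightarrow> 'v list" where
  "tsub hs gs = map2 (-) hs gs"

text \<open>Uncorrected forward pass: hs f0 f x th n = [h_0, ..., h_{n-1}].\<close>
fun hs :: "('x \<Rightarrow> real list \<Rightarrow> 'v) \<Rightarrow> (nat \<Rightarrow> 'v list \<Rightarrow> real list \<Rightarrow> 'v)
           \<Rightarrow> 'x \<Rightarrow> (nat \<Rightarrow> real list) \<Rightarrow> nat \<Rightarrow> 'v list" where
  "hs f0 f x th 0 = []"
| "hs f0 f x th (Suc n) =
     (if n = 0 then [f0 x (th 0)] else hs f0 f x th n @ [f n (hs f0 f x th n) (th n)])"

definition hid :: "('x \<Rightarrow> real list \<Rightarrow> 'v) \<Rightarrow> (nat \<Rightarrow> 'v list \<Rightarrow> real list \<Rightarrow> 'v)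
           \<Rightarrow> 'x \<Rightarrow> (nat \<Rightarrow> real list) \<Rightarrow> nat \<Rightarrow> 'v" where
  "hid f0 f x th i = hs f0 f x th (Suc i) ! i"

definition hout :: "('x \<Rightarrow> real list \<Rightarrow> 'v) \<Rightarrow> (nat \<Rightarrow> 'v list \<Rightarrow> real list \<Rightarrow> 'v)
           \<Rightarrow> ('v list \<Rightarrow> real list \<Rightarrow> real) \<Rightarrow> nat \<Rightarrow> 'x \<Rightarrow> (nat \<Rightarrow> real list) \<Rightarrow> real" where
  "hout f0 f fL L x th = fL (hs f0 f x th L) (th L)"

text \<open>Corrected forward pass: ths ... n = [h~_0, ..., h~_{n-1}], where
  h~_i = c_i(g_i), g_0 = f_0(x,th_0), g_i = f_i(h~_0..h~_{i-1}, th_i).\<close>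
fun ths :: "('x \<Rightarrow> real list \<Rightarrow> 'v) \<Rightarrow> (nat \<Rightarrow> 'v list \<Rightarrow> real list \<Rightarrow> 'v)
           \<Rightarrow> (nat \<Rightarrow> 'v \<Rightarrow> real list \<Rightarrow> 'v)
           \<Rightarrow> 'x \<Rightarrow> (nat \<Rightarrow> real list) \<Rightarrow> (nat \<Rightarrow> real list) \<Rightarrow> nat \<Rightarrow> 'v list" where
  "ths f0 f c x th xi 0 = []"
| "ths f0 f c x th xi (Suc n) =
     ths f0 f c x th xi n @
       [c n (if n = 0 then f0 x (th 0) else f n (ths f0 f c x th xi n) (th n)) (xi n)]"

definition Fcorr :: "('x \<Rightarrow> real list \<Rightarrow> 'v) \<Rightarrow> (nat \<Rightarrow> 'v list \<Rightarrow> real list \<Rightarrow> 'v)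
           \<Rightarrow> ('v list \<Rightarrow> real list \<Rightarrow> real) \<Rightarrow> (nat \<Rightarrow> 'v \<Rightarrow> real list \<Rightarrow> 'v) \<Rightarrow> nat
           \<Rightarrow> 'x \<Rightarrow> (nat \<Rightarrow> real list) \<Rightarrow> (nat \<Rightarrow> real list) \<Rightarrow> real" where
  "Fcorr f0 f fL c L x th xi = fL (ths f0 f c x th xi L) (th L)"

definition nice :: "('v::real_normed_vector list \<Rightarrow> real list \<Rightarrow> 'o::real_normed_vector)
      \<Rightarrow> real list \<Rightarrow> real \<Rightarrow> real \<Rightarrow> real \<Rightarrow> real \<Rightarrow> 'v list set \<Rightarrow> bool" where
  "nice g th k_th k_h s_h s_th H \<longleftrightarrow>
     (\<forall>th'. length th' = length th \<and> l2 (vsub th th') \<le> s_th \<longrightarrow>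
        (\<forall>h\<in>H.
           norm (g h th - g h th') \<le> k_th * l2 (vsub th th') * max (tnorm h) 1 \<and>
           (\<forall>h'. length h' = length h \<and> tnorm (tsub h h') \<le> s_h \<longrightarrow>
               norm (g h th' - g h' th') \<le> k_h * tnorm (tsub h h'))))"

text \<open>All-layer margin of a model G with (flat) parameter vector p; the minimum
  is taken as an infimum in the extended reals (infinite if no flip exists).\<close>
definition all_layer_margin :: "(real list \<Rightarrow> real) \<Rightarrow> real list \<Rightarrow> real \<Rightarrow> ereal" where
  "all_layer_margin G p y =
     Inf {ereal (l2 d) | d. length d = length p \<and> (y - 1/2) * G (vadd p d) \<le> 0}"

definition ind_nonneg :: "real \<Rightarrow> real" where
  "ind_nonneg t = (if t \<ge> 0 then 1 else 0)"

fun split_lens :: "nat list \<Rightarrow> 'a list \<Rightarrow> 'a list list" where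
  "split_lens [] v = []"
| "split_lens (n # ns) v = take n v # split_lens ns (drop n v)"

definition blocks :: "nat \<Rightarrow> (nat \<Rightarrow> real list) \<Rightarrow> (nat \<Rightarrow> real list) \<Rightarrow> real list list" where
  "blocks L th xi = map th [0..<Suc L] @ map xi [0..<L]"

definition Fflat :: "('x \<Rightarrow> real list \<Rightarrow> 'v) \<Rightarrow> (nat \<Rightarrow> 'v list \<Rightarrow> real list \<Rightarrow> 'v)
           \<Rightarrow> ('v list \<Rightarrow> real list \<Rightarrow> real) \<Rightarrow> (nat \<Rightarrow> 'v \<Rightarrow> real list \<Rightarrow> 'v) \<Rightarrow> nat
           \<Rightarrow> (nat \<Rightarrow> real list) \<Rightarrow> (nat \<Rightarrow> real list) \<Rightarrow> 'x \<Rightarrow> real list \<Rightarrow> real" where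
  "Fflat f0 f fL c L th xi x v =
     (let bs = split_lens (map length (blocks L th xi)) v
      in Fcorr f0 f fL c L x (\<lambda>i. bs ! i) (\<lambda>i. bs ! (Suc L + i)))"

text \<open>Layer-based weight-shared model F'(x,theta') = F(x, tau1 theta', tau2 theta'),
  where tau1_i theta' = (theta'_{pi1 i ! 0}, ...), tau2_i likewise with pi2.\<close>
definition select :: "nat list \<Rightarrow> real list \<Rightarrow> real list" where
  "select idx v = map (\<lambda>j. v ! j) idx"

definition Fshared :: "('x \<Rightarrow> real list \<Rightarrow> 'v) \<Rightarrow> (nat \<Rightarrow> 'v list \<Rightarrow> real list \<Rightarrow> 'v)
           \<Rightarrow> ('v list \<Rightarrow> real list \<Rightarrow> real) \<Rightarrow> (nat \<Rightarrow> 'v \<Rightarrow> real list \<Rightarrow> 'v) \<Rightarrow> nat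
           \<Rightarrow> (nat \<Rightarrow> nat list) \<Rightarrow> (nat \<Rightarrow> nat list) \<Rightarrow> 'x \<Rightarrow> real list \<Rightarrow> real" where
  "Fshared f0 f fL c L pi1 pi2 x v =
     Fcorr f0 f fL c L x (\<lambda>i. select (pi1 i) v) (\<lambda>i. select (pi2 i) v)"

end

theory Submission
  imports Defs
begin

text \<open>If every block of a perturbation has norm at most e, then layer by layer the perturbed
  \<open>g\<^sub>i\<close> stays within rho of the true hidden state \<open>h\<^sub>i\<close>: half of rho is spent on the parameters of
  \<open>f\<^sub>i\<close>, half on its inputs. The unperturbed correction would then return \<open>h\<^sub>i\<close> exactly, so the
  perturbed one is off by at most \<open>2 k_xi B e\<close>; in particular errors do not accumulate with depth.
  The output moves by at most rho, which is below 1, and cannot change sign.\<close>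

section \<open>Norms of parameter vectors and tuples\<close>

lemma sum_list_squares_nonneg: "0 \<le> (\<Sum>a\<leftarrow>v. (a::real)\<^sup>2)"
  by (rule sum_list_nonneg) auto

lemma l2_nonneg: "0 \<le> l2 v"
  by (simp add: l2_def sum_list_squares_nonneg)

lemma l2_map_uminus [simp]: "l2 (map uminus v) = l2 v"
  by (simp add: l2_def comp_def)

lemma l2_append_ge: "l2 u \<le> l2 (u @ v)" "l2 v \<le> l2 (u @ v)"
  by (simp_all add: l2_def sum_list_squares_nonneg)

lemma l2_take_le: "l2 (take n d) \<le> l2 d"
  by (metis append_take_drop_id l2_append_ge(1))

lemma l2_drop_le: "l2 (drop n d) \<le> l2 d"
  by (metis append_take_drop_id l2_append_ge(2))

text \<open>Distinctness makes the selected squares a subsum of the squares of \<open>d\<close>; a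
  repeated index would be counted twice.\<close>

lemma l2_select_le:
  assumes "distinct idx" "set idx \<subseteq> {..<length d}"
  shows "l2 (select idx d) \<le> l2 d"
proof -
  have "(\<Sum>j\<leftarrow>idx. (d ! j)\<^sup>2) = (\<Sum>j\<in>set idx. (d ! j)\<^sup>2)"
    using assms(1) by (rule sum_list_distinct_conv_sum_set)
  also have "\<dots> \<le> (\<Sum>j<length d. (d ! j)\<^sup>2)"
    using assms(2) by (intro sum_mono2) auto
  also have "\<dots> = (\<Sum>a\<leftarrow>d. a\<^sup>2)"
    by (simp add: sum_list_sum_nth atLeast0LessThan)
  finally show ?thesis
    by (simp add: l2_def select_def comp_def)
qed

lemma vsub_vadd_self: "length d = length v \<Longrightarrow> vsub v (vadd v d) = map uminus d"
  by (induction d v rule: list_induct2) (auto simp: vsub_def vadd_def)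

lemma select_vadd:
  assumes "set idx \<subseteq> {..<length v}" "length d = length v"
  shows "select idx (vadd v d) = vadd (select idx v) (select idx d)"
  using assms by (intro nth_equalityI) (auto simp: select_def vadd_def subset_iff)

lemma tnorm_le:
  assumes "0 \<le> r" "\<And>v. v \<in> set vs \<Longrightarrow> norm v \<le> r"
  shows "tnorm vs \<le> r"
  using assms(2) by (induction vs) (auto simp: tnorm_def assms(1))

section \<open>Perturbed blocks\<close>

text \<open>Cutting at the original block lengths perturbs each block by its own segment of
  \<open>d\<close>, and a segment has norm at most that of \<open>d\<close>. The remaining blocks
  are perturbed by the rest of \<open>d\<close>, so the induction generalizes over
  \<open>d\<close>.\<close>

lemma split_lens_vadd_concat:
  assumes "length d = length (concat bs)" "i < length bs"
  shows "length (split_lens (map length bs) (vadd (concat bs) d) ! i) = length (bs ! i) \<and>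
         l2 (vsub (bs ! i) (split_lens (map length bs) (vadd (concat bs) d) ! i)) \<le> l2 d"
  using assms
proof (induction bs arbitrary: d i)
  case (Cons b bs)
  let ?d1 = "take (length b) d" and ?d2 = "drop (length b) d"
  have t: "take (length b) (vadd (concat (b # bs)) d) = vadd b ?d1"
    by (simp add: vadd_def take_map take_zip)
  have d: "drop (length b) (vadd (concat (b # bs)) d) = vadd (concat bs) ?d2"
    by (simp add: vadd_def drop_map drop_zip)
  have l: "length ?d1 = length b" "length ?d2 = length (concat bs)"
    using Cons.prems(1) by auto
  show ?case
  proof (cases i)
    case 0
    have "l2 (vsub b (vadd b ?d1)) \<le> l2 d"
      using l(1) by (simp add: vsub_vadd_self l2_take_le)
    moreover have "length (vadd b ?d1) = length b"
      using l(1) by (simp add: vadd_def)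
    ultimately show ?thesis
      unfolding 0 list.map split_lens.simps nth_Cons_0 t by blast
  next
    case (Suc j)
    with Cons.prems(2) have "j < length bs" by simp
    from Cons.IH[OF l(2) this] show ?thesis
      unfolding Suc list.map split_lens.simps nth_Cons_Suc d
      using l2_drop_le[of "length b" d] by linarith
  qed
qed simp

text \<open>The family \<open>th\<close> fills the indices 0 to \<open>L\<close>, so
  \<open>xi\<close> starts at \<open>Suc L\<close>.\<close>

lemma blocks_nth:
  "i \<le> L \<Longrightarrow> blocks L th xi ! i = th i"
  "i < L \<Longrightarrow> blocks L th xi ! (Suc L + i) = xi i"
  by (auto simp: blocks_def nth_append simp del: upt_Suc)

lemma length_blocks: "length (blocks L th xi) = Suc L + L"
  by (simp add: blocks_def)

lemma select_vadd_close:
  assumes "distinct idx" "set idx \<subseteq> {..<length v}" "length d = length v"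
  shows "length (select idx (vadd v d)) = length (select idx v)"
    and "l2 (vsub (select idx v) (select idx (vadd v d))) \<le> l2 d"
proof -
  show "length (select idx (vadd v d)) = length (select idx v)"
    by (simp add: select_def)
  have "length (select idx d) = length (select idx v)"
    by (simp add: select_def)
  then show "l2 (vsub (select idx v) (select idx (vadd v d))) \<le> l2 d"
    using assms by (simp add: select_vadd vsub_vadd_self l2_select_le)
qed

section \<open>Forward passes\<close>

lemma length_hs [simp]: "length (hs f0 f x th n) = n"
  by (induction n) auto

lemma length_ths [simp]: "length (ths f0 f c x th xi n) = n"
  by (induction n) auto

text \<open>Later layers only append, so the length of the pass does not affect entry
  \<open>i\<close>.\<close>

lemma hs_nth: "i < n \<Longrightarrow> hs f0 f x th n ! i = hid f0 f x th i"
proof (induction n)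
  case (Suc n)
  show ?case
  proof (cases "i = n")
    case True
    then show ?thesis by (simp only: hid_def)
  next
    case False
    with Suc show ?thesis by (auto simp: nth_append)
  qed
qed simp

lemma hid_0: "hid f0 f x th 0 = f0 x (th 0)"
  by (simp add: hid_def)

lemma hid_pos: "0 < i \<Longrightarrow> hid f0 f x th i = f i (hs f0 f x th i) (th i)"
  by (simp add: hid_def nth_append)

lemma ths_nth:
  "i < n \<Longrightarrow> ths f0 f c x th xi n ! i =
     c i (if i = 0 then f0 x (th 0) else f i (ths f0 f c x th xi i) (th i)) (xi i)"
  by (induction n) (auto simp: nth_append less_Suc_eq)

lemma ths_cong:
  "\<forall>i<n. th i = th' i \<and> xi i = xi' i \<Longrightarrow> ths f0 f c x th xi n = ths f0 f c x th' xi' n"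
  by (induction n) auto

text \<open>Parameter families are functions on all naturals, whereas weight sharing and block
  splitting determine them only at the indices that the model reads.\<close>

lemma Fcorr_cong:
  assumes "\<forall>i\<le>L. th i = th' i" "\<forall>i<L. xi i = xi' i"
  shows "Fcorr f0 f fL c L x th xi = Fcorr f0 f fL c L x th' xi'"
proof -
  have "ths f0 f c x th xi L = ths f0 f c x th' xi' L"
    using assms by (intro ths_cong) auto
  then show ?thesis using assms(1) by (simp add: Fcorr_def)
qed

text \<open>When \<open>\<delta> = 0\<close> the inputs agree, and neither \<open>s_h\<close> nor \<open>k_h\<close> is constrained: both may be
  negative.\<close>

lemma nice_perturbation:
  assumes nice: "nice g t k_th k_h s_h s_th H"
    and h: "h \<in> H" and t': "length t' = length t" "l2 (vsub t t') \<le> e" and e: "e \<le> s_th"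
    and h': "length h' = length h" "\<forall>j<length h. norm (h ! j - h' ! j) \<le> \<delta>"
    and \<delta>: "0 \<le> \<delta>" "0 < \<delta> \<Longrightarrow> \<delta> \<le> s_h \<and> 0 \<le> k_h"
    and B: "1 \<le> B" "\<forall>j<length h. norm (h ! j) \<le> B" and k_th: "0 \<le> k_th"
  shows "norm (g h t - g h' t') \<le> k_th * B * e + k_h * \<delta>"
proof -
  \<comment> \<open>The estimate goes from \<open>(h, t)\<close> over \<open>(h, t')\<close> to
    \<open>(h', t')\<close>: niceness bounds the parameter change at the exact input
    \<open>h\<close>, and the input change at the perturbed parameter \<open>t'\<close>.\<close>
  note N = nice[unfolded nice_def, rule_format, of t', OF conjI[OF t'(1) order_trans[OF t'(2) e]] h]
  have "tnorm h \<le> B"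
    using B by (intro tnorm_le) (auto simp: in_set_conv_nth)
  then have "norm (g h t - g h t') \<le> k_th * e * B"
    using N[THEN conjunct1] k_th t'(2) l2_nonneg[of "vsub t t'"] B(1)
    by (elim order_trans) (intro mult_mono mult_nonneg_nonneg, auto)
  moreover have "norm (g h t' - g h' t') \<le> k_h * \<delta>"
  proof (cases "\<delta> = 0")
    case True
    with h' have "h' = h" by (intro nth_equalityI) auto
    with True show ?thesis by simp
  next
    case False
    with \<delta> have "\<delta> \<le> s_h" "0 \<le> k_h" by auto
    have "tnorm (tsub h h') \<le> \<delta>"
      using h' \<delta>(1) by (intro tnorm_le) (auto simp: in_set_conv_nth tsub_def)
    moreover from this \<open>\<delta> \<le> s_h\<close> N[THEN conjunct2] h'(1)
    have "norm (g h t' - g h' t') \<le> k_h * tnorm (tsub h h')" by auto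
    ultimately show ?thesis
      using \<open>0 \<le> k_h\<close> by (elim order_trans) (rule mult_left_mono)
  qed
  ultimately show ?thesis
    using norm_triangle_ineq[of "g h t - g h t'" "g h t' - g h' t'"] by (simp add: mult_ac)
qed

text \<open>The sign of \<open>k\<close> is open, so every case has to be read off. In
  \<open>ereal\<close> a positive number over 0 is infinite, 0 over 0 is 0 and a negative number
  over 0 is minus infinity; hence \<open>k = 0\<close> forces \<open>0 < a\<close>.\<close>

lemma ereal_less_divideD:
  assumes "ereal e < ereal a / ereal k" "0 \<le> e"
  shows "0 < k \<and> k * e < a \<or> k = 0 \<and> 0 < a \<or> k < 0 \<and> a < 0"
proof (cases "k = 0")
  case True
  with assms show ?thesis by (cases "a = 0"; cases "a > 0") (auto simp: divide_ereal_def)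
next
  case False
  with assms have "e < a / k" by simp
  with False assms(2) show ?thesis
    by (cases "k > 0") (auto simp: field_simps dest: order.strict_trans1, smt (verit) mult_nonneg_nonpos)
qed

section \<open>Stability of corrected models\<close>

locale corrected_model =
  fixes X :: "'x set"
    and f0 :: "'x \<Rightarrow> real list \<Rightarrow> 'v::euclidean_space"
    and f :: "nat \<Rightarrow> 'v list \<Rightarrow> real list \<Rightarrow> 'v"
    and fL :: "'v list \<Rightarrow> real list \<Rightarrow> real"
    and c :: "nat \<Rightarrow> 'v \<Rightarrow> real list \<Rightarrow> 'v"
    and L :: nat
    and th xi :: "nat \<Rightarrow> real list"
    and k0 k_th k_h k_xi s_h s_th s_xi B rho :: real
  assumes L_pos: "1 \<le> L"
    and C1_f: "\<forall>i. 1 \<le> i \<and> i < L \<longrightarrow>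
                 nice (f i) (th i) k_th k_h s_h s_th {hs f0 f x th i | x. x \<in> X}"
    and C1_fL: "nice fL (th L) k_th k_h s_h s_th {hs f0 f x th L | x. x \<in> X}"
    and C1_f0: "\<forall>x\<in>X. \<forall>th0'. length th0' = length (th 0) \<longrightarrow>
                  norm (f0 x (th 0) - f0 x th0') \<le> k0 * l2 (vsub (th 0) th0')"
    and C1_c: "\<forall>i<L. \<forall>h. \<forall>xi'. length xi' = length (xi i) \<and> l2 (vsub (xi i) xi') \<le> s_xi \<longrightarrow>
                  norm (c i h (xi i) - c i h xi') \<le> k_xi * max (norm h) 1 * l2 (vsub (xi i) xi')"
    and C2: "\<forall>x\<in>X. (\<forall>i<L. max (norm (hid f0 f x th i)) 1 \<le> B) \<and>
                    max \<bar>hout f0 f fL L x th\<bar> 1 \<le> B"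
    and radius: "\<forall>i<L. \<forall>x\<in>X. \<forall>h'. norm (h' - hid f0 f x th i) \<le> rho \<longrightarrow>
                    c i h' (xi i) = hid f0 f x th i"
    and rho_lt1: "rho < 1"
    and F_pm1: "\<forall>x\<in>X. Fcorr f0 f fL c L x th xi \<in> {-1, 1}"
begin

definition margin_bound :: ereal where
  "margin_bound = Min {ereal B / ereal k0, ereal rho / ereal k0, ereal s_th, ereal s_xi,
     1 / ereal (2 * k_th), ereal rho / ereal (2 * k_th * B),
     ereal s_h / ereal (2 * k_xi * B), ereal rho / ereal (4 * B * k_h * k_xi),
     1 / ereal (4 * k_h * k_xi)}"

lemma B_ge_1: "x \<in> X \<Longrightarrow> 1 \<le> B"
  using C2 by fastforce

lemma norm_hid_le: "x \<in> X \<Longrightarrow> i < L \<Longrightarrow> norm (hid f0 f x th i) \<le> B"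
  using C2 by fastforce

text \<open>With \<open>0 \<le> rho\<close> each hidden state lies within its own radius, so the
  correction fixes it and the two passes agree inductively.\<close>

lemma ths_eq_hs:
  assumes "x \<in> X" "0 \<le> rho" "n \<le> L"
  shows "ths f0 f c x th xi n = hs f0 f x th n"
  using assms(3)
proof (induction n)
  case (Suc n)
  have "c n (hid f0 f x th n) (xi n) = hid f0 f x th n"
    using radius assms Suc.prems by auto
  then show ?case
    using Suc by (cases "n = 0") (auto simp: hid_0 hid_pos)
qed simp

lemma Fcorr_eq_hout:
  assumes "x \<in> X" "0 \<le> rho"
  shows "Fcorr f0 f fL c L x th xi = hout f0 f fL L x th"
  using ths_eq_hs[OF assms order_refl] by (simp add: Fcorr_def hout_def)

text \<open>The error \<open>\<delta>\<close> of the corrected states is the same at every layer: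
  the exact correction removes what earlier layers contributed, and changing \<open>xi i\<close> to
  \<open>xi' i\<close> costs at most \<open>2 * k_xi * B * e\<close>.\<close>

lemma Fcorr_perturbation:
  assumes x: "x \<in> X"
    and th': "\<forall>i\<le>L. length (th' i) = length (th i) \<and> l2 (vsub (th i) (th' i)) \<le> e"
    and xi': "\<forall>i<L. length (xi' i) = length (xi i) \<and> l2 (vsub (xi i) (xi' i)) \<le> e"
    and e: "e \<le> s_th" "e \<le> s_xi" "k0 * e \<le> rho" "k_th * B * e + k_h * \<delta> \<le> rho"
    and \<delta>: "0 \<le> \<delta>" "2 * k_xi * B * e \<le> \<delta>" "0 < \<delta> \<Longrightarrow> \<delta> \<le> s_h \<and> 0 \<le> k_h"
    and nonneg: "0 \<le> k0" "0 \<le> k_th"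
  shows "\<bar>hout f0 f fL L x th - Fcorr f0 f fL c L x th' xi'\<bar> \<le> rho"
proof -
  have B: "1 \<le> B" using B_ge_1 x .
  \<comment> \<open>The codomain of \<open>g\<close> is left open, so that one bound serves both the
    hidden layers \<open>f i\<close> and the output \<open>fL\<close>.\<close>
  have layer: "norm (g (hs f0 f x th n) (th n) - g (ths f0 f c x th' xi' n) (th' n)) \<le> rho"
    if "nice g (th n) k_th k_h s_h s_th {hs f0 f x th n | x. x \<in> X}" "n \<le> L"
      "\<forall>j<n. norm (hid f0 f x th j - ths f0 f c x th' xi' n ! j) \<le> \<delta>"
    for n and g :: "'v list \<Rightarrow> real list \<Rightarrow> 'o::real_normed_vector"
  proof -
    have "norm (g (hs f0 f x th n) (th n) - g (ths f0 f c x th' xi' n) (th' n))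
      \<le> k_th * B * e + k_h * \<delta>"
      using that x th' e(1) \<delta> B nonneg
      by (intro nice_perturbation[where t = "th n" and t' = "th' n" and s_h = s_h, OF that(1)])
        (auto simp: hs_nth norm_hid_le)
    with e(4) show ?thesis by linarith
  qed
  have hidden: "norm (hid f0 f x th i - ths f0 f c x th' xi' n ! i) \<le> \<delta>"
    if "i < n" "n \<le> L" for i n
    using that
  \<comment> \<open>Layer \<open>i\<close> reads the pass of length \<open>i\<close>, so the
    induction hypothesis is needed at that length instead of \<open>n\<close>.\<close>
  proof (induction i arbitrary: n rule: less_induct)
    case (less i)
    define g where "g = (if i = 0 then f0 x (th' 0) else f i (ths f0 f c x th' xi' i) (th' i))"
    have iL: "i < L" using less.prems by simp
    have g: "norm (hid f0 f x th i - g) \<le> rho"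
    proof (cases "i = 0")
      case True
      have "norm (f0 x (th 0) - f0 x (th' 0)) \<le> k0 * l2 (vsub (th 0) (th' 0))"
        using C1_f0 x th' by auto
      also have "\<dots> \<le> k0 * e" using th' nonneg by (intro mult_left_mono) auto
      finally show ?thesis using e(3) True by (simp add: g_def hid_0)
    next
      case False
      then show ?thesis
        using layer[of "f i" i] C1_f iL less.IH[of _ i] by (auto simp: g_def hid_pos)
    qed
    have "norm g \<le> norm (hid f0 f x th i) + norm (hid f0 f x th i - g)"
      using norm_triangle_sub[of g "hid f0 f x th i"] by (simp add: norm_minus_commute)
    \<comment> \<open>This is the source of the factor 2: \<open>norm g\<close> is at most
      \<open>B + rho\<close>, with \<open>rho < 1\<close> and \<open>1 \<le> B\<close>.\<close>
    then have gB: "max (norm g) 1 \<le> 2 * B"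
      using g norm_hid_le[OF x iL] rho_lt1 B by simp
    have "c i g (xi i) = hid f0 f x th i"
      using radius iL x g by (simp add: norm_minus_commute)
    moreover have "norm (c i g (xi i) - c i g (xi' i))
        \<le> k_xi * max (norm g) 1 * l2 (vsub (xi i) (xi' i))"
      using C1_c iL xi' e(2) by (meson order_trans)
    moreover have "k_xi * max (norm g) 1 * l2 (vsub (xi i) (xi' i)) \<le> \<delta>"
    \<comment> \<open>For negative \<open>k_xi\<close> the bound \<open>gB\<close> would work in the
      wrong direction, but then the product is already at most 0.\<close>
    proof (cases "0 \<le> k_xi")
      case True
      have "k_xi * max (norm g) 1 * l2 (vsub (xi i) (xi' i)) \<le> k_xi * (2 * B) * e"
        using True gB B xi' iL l2_nonneg by (intro mult_mono mult_nonneg_nonneg) auto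
      with \<delta>(2) show ?thesis by (simp add: mult_ac)
    next
      case False
      then have "k_xi * max (norm g) 1 * l2 (vsub (xi i) (xi' i)) \<le> 0"
        using l2_nonneg by (intro mult_nonpos_nonneg) auto
      with \<delta>(1) show ?thesis by linarith
    qed
    moreover have "ths f0 f c x th' xi' n ! i = c i g (xi' i)"
      using less.prems by (simp add: ths_nth g_def)
    ultimately show ?case by simp
  qed
  show ?thesis
    using layer[OF C1_fL] hidden[of _ L] by (simp add: hout_def Fcorr_def)
qed

text \<open>The terms of \<open>margin_bound\<close> supply the hypotheses of
  \<open>Fcorr_perturbation\<close>: besides the size conditions on \<open>e\<close>, they also
  force the signs of the constants.\<close>

lemma Fcorr_no_flip:
  assumes x: "x \<in> X"
    and th': "\<forall>i\<le>L. length (th' i) = length (th i) \<and> l2 (vsub (th i) (th' i)) \<le> e"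
    and xi': "\<forall>i<L. length (xi' i) = length (xi i) \<and> l2 (vsub (xi i) (xi' i)) \<le> e"
    and e: "0 \<le> e" "ereal e < margin_bound"
  shows "0 < (ind_nonneg (Fcorr f0 f fL c L x th xi) - 1/2) * Fcorr f0 f fL c L x th' xi'"
proof -
  have B: "1 \<le> B" using B_ge_1 x .
  note D = ereal_less_divideD[OF _ e(1)]
  have b: "ereal e < ereal B / ereal k0" "ereal e < ereal rho / ereal k0"
    "e < s_th" "e < s_xi" "ereal e < ereal 1 / ereal (2 * k_th)"
    "ereal e < ereal rho / ereal (2 * k_th * B)" "ereal e < ereal s_h / ereal (2 * k_xi * B)"
    "ereal e < ereal rho / ereal (4 * B * k_h * k_xi)" "ereal e < ereal 1 / ereal (4 * k_h * k_xi)"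
    using e(2) unfolding margin_bound_def one_ereal_def
    by (simp_all only: Min_gr_iff finite_insert finite.emptyI insert_not_empty simp_thms
        ball_simps less_ereal.simps)
  \<comment> \<open>Since \<open>B\<close> is positive, \<open>B / k0\<close> can exceed the
    nonnegative \<open>e\<close> only for \<open>k0 \<ge> 0\<close>. The terms with numerator 1
    settle the signs of \<open>k_th\<close> and \<open>k_h * k_xi\<close> in the same way.\<close>
  have k0: "0 \<le> k0" using D[OF b(1)] B by auto
  then have rho: "0 < rho" "k0 * e \<le> rho"
    using D[OF b(2)] mult_nonneg_nonneg[OF k0 e(1)] by force+
  have k_th: "0 \<le> k_th" using D[OF b(5)] by auto
  have th_half: "k_th * B * e \<le> rho / 2"
    using D[OF b(6)] rho(1) B by auto
  \<comment> \<open>The maximum with 0 covers a negative \<open>k_xi\<close>. If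
    \<open>\<delta>\<close> is positive, so is \<open>k_xi\<close>, and the terms containing
    \<open>k_xi\<close> give information on \<open>s_h\<close> and \<open>k_h\<close>.\<close>
  define \<delta> where "\<delta> = max 0 (2 * k_xi * B * e)"
  have \<delta>: "\<delta> \<le> s_h \<and> 0 \<le> k_h" if "0 < \<delta>"
  proof -
    have "0 < k_xi * (B * e)" using that by (auto simp: \<delta>_def mult_ac split: if_splits)
    moreover have "0 \<le> B * e" using B e(1) by simp
    ultimately have k_xi: "0 < k_xi" by (simp add: zero_less_mult_iff)
    then have "2 * k_xi * B * e < s_h"
      using D[OF b(7)] B by (auto simp: mult_less_0_iff)
    moreover have "0 \<le> k_h"
      using D[OF b(9)] k_xi by (auto simp: zero_less_mult_iff mult_less_0_iff)
    ultimately show ?thesis using that by (auto simp: \<delta>_def)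
  qed
  have h_half: "k_h * \<delta> \<le> rho / 2"
  proof (cases "0 < \<delta>")
    case True
    then have "\<delta> = 2 * k_xi * B * e" unfolding \<delta>_def by linarith
    \<comment> \<open>The 4 in \<open>4 * B * k_h * k_xi\<close> is the 2 in \<open>\<delta>\<close>
      times another 2 that leaves half of \<open>rho\<close> for the parameters.\<close>
    then have "k_h * \<delta> = 2 * B * k_h * k_xi * e" by simp
    moreover have "4 * B * k_h * k_xi * e \<le> rho"
      using D[OF b(8)] rho(1) by auto
    ultimately show ?thesis by linarith
  next
    case False
    then have "\<delta> = 0" by (simp add: \<delta>_def)
    with rho show ?thesis by simp
  qed
  have "\<bar>hout f0 f fL L x th - Fcorr f0 f fL c L x th' xi'\<bar> \<le> rho"
    using b(3,4) rho(2) th_half h_half \<delta> k0 k_th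
    by (intro Fcorr_perturbation[OF x th' xi', of \<delta>]) (auto simp: \<delta>_def)
  \<comment> \<open>As \<open>rho\<close> is positive, \<open>hout\<close> equals the corrected
    output at the exact parameters.\<close>
  then have "\<bar>Fcorr f0 f fL c L x th xi - Fcorr f0 f fL c L x th' xi'\<bar> < 1"
    using rho_lt1 rho(1) Fcorr_eq_hout[OF x] by simp
  moreover have "Fcorr f0 f fL c L x th xi = -1 \<or> Fcorr f0 f fL c L x th xi = 1"
    using F_pm1 x by auto
  ultimately show ?thesis by (auto simp: ind_nonneg_def abs_less_iff)
qed

text \<open>This separates stability from the parametrization: it suffices that a perturbation
  \<open>d\<close> of the parameters of \<open>G\<close> moves each layer by at most
  \<open>l2 d\<close>. A flipping \<open>d\<close> below the bound would contradict
  \<open>Fcorr_no_flip\<close>; if nothing flips, the infimum is infinite.\<close>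

lemma all_layer_margin_ge:
  assumes x: "x \<in> X"
    and G: "\<And>d. length d = length p \<Longrightarrow> \<exists>th' xi'. G (vadd p d) = Fcorr f0 f fL c L x th' xi' \<and>
        (\<forall>i\<le>L. length (th' i) = length (th i) \<and> l2 (vsub (th i) (th' i)) \<le> l2 d) \<and>
        (\<forall>i<L. length (xi' i) = length (xi i) \<and> l2 (vsub (xi i) (xi' i)) \<le> l2 d)"
  shows "margin_bound \<le> all_layer_margin G p (ind_nonneg (Fcorr f0 f fL c L x th xi))"
  unfolding all_layer_margin_def
proof (rule Inf_greatest)
  fix r
  assume "r \<in> {ereal (l2 d) | d. length d = length p \<and>
    (ind_nonneg (Fcorr f0 f fL c L x th xi) - 1/2) * G (vadd p d) \<le> 0}"
  then obtain d where d: "r = ereal (l2 d)" "length d = length p"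
    "(ind_nonneg (Fcorr f0 f fL c L x th xi) - 1/2) * G (vadd p d) \<le> 0"
    by blast
  obtain th' xi' where "G (vadd p d) = Fcorr f0 f fL c L x th' xi'"
    "\<forall>i\<le>L. length (th' i) = length (th i) \<and> l2 (vsub (th i) (th' i)) \<le> l2 d"
    "\<forall>i<L. length (xi' i) = length (xi i) \<and> l2 (vsub (xi i) (xi' i)) \<le> l2 d"
    using G[OF d(2)] by blast
  with d(3) Fcorr_no_flip[OF x, of th' "l2 d" xi'] l2_nonneg[of d] show "margin_bound \<le> r"
    unfolding d(1) by (metis linorder_not_le)
qed

lemma Fflat_margin_ge:
  assumes x: "x \<in> X"
  shows "margin_bound \<le> all_layer_margin (Fflat f0 f fL c L th xi x) (concat (blocks L th xi))
    (ind_nonneg (Fcorr f0 f fL c L x th xi))"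
proof (rule all_layer_margin_ge[OF x])
  fix d :: "real list"
  assume d: "length d = length (concat (blocks L th xi))"
  let ?bs = "split_lens (map length (blocks L th xi)) (vadd (concat (blocks L th xi)) d)"
  have "length (?bs ! i) = length (th i) \<and> l2 (vsub (th i) (?bs ! i)) \<le> l2 d" if "i \<le> L" for i
    using split_lens_vadd_concat[OF d, of i] that by (simp add: length_blocks blocks_nth)
  moreover have "length (?bs ! (Suc L + i)) = length (xi i) \<and>
      l2 (vsub (xi i) (?bs ! (Suc L + i))) \<le> l2 d" if "i < L" for i
    using split_lens_vadd_concat[OF d, of "Suc L + i"] that
    by (simp add: length_blocks blocks_nth(2) del: add_Suc)
  ultimately show "\<exists>th' xi'. Fflat f0 f fL c L th xi x (vadd (concat (blocks L th xi)) d) =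
      Fcorr f0 f fL c L x th' xi' \<and>
      (\<forall>i\<le>L. length (th' i) = length (th i) \<and> l2 (vsub (th i) (th' i)) \<le> l2 d) \<and>
      (\<forall>i<L. length (xi' i) = length (xi i) \<and> l2 (vsub (xi i) (xi' i)) \<le> l2 d)"
    by (intro exI[of _ "\<lambda>i. ?bs ! i"] exI[of _ "\<lambda>i. ?bs ! (Suc L + i)"])
      (simp add: Fflat_def Let_def del: add_Suc)
qed

text \<open>A coordinate shared by several layers perturbs all of them, but stability only asks for
  a bound on each layer separately, and within one layer no coordinate is repeated.\<close>

lemma Fshared_margin_ge:
  assumes x: "x \<in> X"
    and pi1: "\<forall>i\<le>L. distinct (pi1 i) \<and> set (pi1 i) \<subseteq> {..<length v}" "\<forall>i\<le>L. select (pi1 i) v = th i"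
    and pi2: "\<forall>i<L. distinct (pi2 i) \<and> set (pi2 i) \<subseteq> {..<length v}" "\<forall>i<L. select (pi2 i) v = xi i"
  shows "margin_bound \<le> all_layer_margin (Fshared f0 f fL c L pi1 pi2 x) v
    (ind_nonneg (Fshared f0 f fL c L pi1 pi2 x v))"
proof -
  have "Fshared f0 f fL c L pi1 pi2 x v = Fcorr f0 f fL c L x th xi"
    unfolding Fshared_def using pi1(2) pi2(2) by (intro Fcorr_cong) auto
  moreover have "margin_bound \<le> all_layer_margin (Fshared f0 f fL c L pi1 pi2 x) v
      (ind_nonneg (Fcorr f0 f fL c L x th xi))"
  proof (rule all_layer_margin_ge[OF x])
    fix d :: "real list"
    assume d: "length d = length v"
    let ?t = "\<lambda>i. select (pi1 i) (vadd v d)" and ?u = "\<lambda>i. select (pi2 i) (vadd v d)"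
    have "\<forall>i\<le>L. length (?t i) = length (th i) \<and> l2 (vsub (th i) (?t i)) \<le> l2 d"
      using select_vadd_close[OF _ _ d] pi1 by metis
    moreover have "\<forall>i<L. length (?u i) = length (xi i) \<and> l2 (vsub (xi i) (?u i)) \<le> l2 d"
      using select_vadd_close[OF _ _ d] pi2 by metis
    ultimately show "\<exists>th' xi'. Fshared f0 f fL c L pi1 pi2 x (vadd v d) =
        Fcorr f0 f fL c L x th' xi' \<and>
        (\<forall>i\<le>L. length (th' i) = length (th i) \<and> l2 (vsub (th i) (th' i)) \<le> l2 d) \<and>
        (\<forall>i<L. length (xi' i) = length (xi i) \<and> l2 (vsub (xi i) (xi' i)) \<le> l2 d)"
      unfolding Fshared_def by blast
  qed
  ultimately show ?thesis by simp
qed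

end

theorem mainTheorem9:
  fixes X :: "'x set"
    and f0 :: "'x \<Rightarrow> real list \<Rightarrow> 'v::euclidean_space"
    and f :: "nat \<Rightarrow> 'v list \<Rightarrow> real list \<Rightarrow> 'v"
    and fL :: "'v list \<Rightarrow> real list \<Rightarrow> real"
    and c :: "nat \<Rightarrow> 'v \<Rightarrow> real list \<Rightarrow> 'v"
    and L :: nat
    and th xi :: "nat \<Rightarrow> real list"
    and k0 k_th k_h k_xi s_h s_th s_xi B rho :: real
  assumes L_pos: "1 \<le> L"
    \<comment> \<open>(C1): niceness of the layers f_1..f_{L-1} and f_L\<close>
    and C1_f: "\<forall>i. 1 \<le> i \<and> i < L \<longrightarrow>
                 nice (f i) (th i) k_th k_h s_h s_th
                   {hs f0 f x th i | x. x \<in> X}"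
    and C1_fL: "nice fL (th L) k_th k_h s_h s_th {hs f0 f x th L | x. x \<in> X}"
    \<comment> \<open>(C1): Lipschitz condition for f_0\<close>
    and C1_f0: "\<forall>x\<in>X. \<forall>th0'. length th0' = length (th 0) \<longrightarrow>
                  norm (f0 x (th 0) - f0 x th0') \<le> k0 * l2 (vsub (th 0) th0')"
    \<comment> \<open>(C1): condition on the correction functions\<close>
    and C1_c: "\<forall>i<L. \<forall>h. \<forall>xi'. length xi' = length (xi i) \<and> l2 (vsub (xi i) xi') \<le> s_xi \<longrightarrow>
                  norm (c i h (xi i) - c i h xi') \<le> k_xi * max (norm h) 1 * l2 (vsub (xi i) xi')"
    \<comment> \<open>(C2)\<close>
    and C2: "\<forall>x\<in>X. (\<forall>i<L. max (norm (hid f0 f x th i)) 1 \<le> B) \<and>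
                    max \<bar>hout f0 f fL L x th\<bar> 1 \<le> B"
    \<comment> \<open>correction functions have radius rho < 1\<close>
    and radius: "\<forall>i<L. \<forall>x\<in>X. \<forall>h'. norm (h' - hid f0 f x th i) \<le> rho \<longrightarrow>
                    c i h' (xi i) = hid f0 f x th i"
    and rho_lt1: "rho < 1"
    and F_pm1: "\<forall>x\<in>X. Fcorr f0 f fL c L x th xi \<in> {-1, 1}"
  shows "(\<forall>x\<in>X.
            all_layer_margin (Fflat f0 f fL c L th xi x) (concat (blocks L th xi))
               (ind_nonneg (Fcorr f0 f fL c L x th xi))
            \<ge> Min {ereal B / ereal k0, ereal rho / ereal k0, ereal s_th, ereal s_xi,
                   1 / ereal (2 * k_th), ereal rho / ereal (2 * k_th * B),
                   ereal s_h / ereal (2 * k_xi * B), ereal rho / ereal (4 * B * k_h * k_xi),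
                   1 / ereal (4 * k_h * k_xi)})
         \<and>
         (\<forall>(d'::nat) (pi1::nat \<Rightarrow> nat list) (pi2::nat \<Rightarrow> nat list) (th'::real list).
            (\<forall>i\<le>L. distinct (pi1 i) \<and> set (pi1 i) \<subseteq> {..<d'}) \<and>
            (\<forall>i<L. distinct (pi2 i) \<and> set (pi2 i) \<subseteq> {..<d'}) \<and>
            length th' = d' \<and>
            (\<forall>i\<le>L. select (pi1 i) th' = th i) \<and>
            (\<forall>i<L. select (pi2 i) th' = xi i) \<longrightarrow>
            (\<forall>x\<in>X.
               all_layer_margin (Fshared f0 f fL c L pi1 pi2 x) th'
                  (ind_nonneg (Fshared f0 f fL c L pi1 pi2 x th'))
               \<ge> Min {ereal B / ereal k0, ereal rho / ereal k0, ereal s_th, ereal s_xi,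
                      1 / ereal (2 * k_th), ereal rho / ereal (2 * k_th * B),
                      ereal s_h / ereal (2 * k_xi * B), ereal rho / ereal (4 * B * k_h * k_xi),
                      1 / ereal (4 * k_h * k_xi)}))"
proof -
  interpret corrected_model X f0 f fL c L th xi k0 k_th k_h k_xi s_h s_th s_xi B rho
    by unfold_locales (fact assms)+
  show ?thesis
    unfolding margin_bound_def[symmetric]
  proof (intro conjI allI impI ballI, goal_cases)
    case (1 x)
    then show ?case by (rule Fflat_margin_ge)
  next
    case (2 d' pi1 pi2 th' x)
    then show ?case by (intro Fshared_margin_ge) simp_all
  qed
qed

end
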